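(* Let $d\in(0,0.5)$ and let $\{M_d(t)\}_{t\in\mathbb{R}}$ be a fractional Lévy process with parameter $d$. Then the sample paths of $M_d$ are $P$-a.s. Hölder continuous of order $d$ at any point $t\in\mathbb{R}$; that is, for $P$-a.e. $\omega$, for every $t\in\mathbb{R}$ there exist $\delta_0=\delta_0(\omega,t)>0$ and $C=C(\omega,t)<\infty$ such that $$|M_d(t+\delta)-M_d(t)|\le C|\delta|^d\qquad\text{for all } \delta\in(-\delta_0,\delta_0).$$
   Context: Fractional Lévy process: let $L=\{L(t)\}_{t\in\mathbb{R}}$ be a two-sided Lévy process on $\mathbb{R}$ (càdlàg, $L(0)=0$, independent and stationary increments) with $E[L(1)]=0$, $E[L(1)^2]<\infty$ and without a Brownian component. For $0<d<0.5$, $$M_d(t)=\int_{-\infty}^{\infty}\frac{1}{\Gamma(d+1)}\big[(t-r)_+^d-(-r)_+^d\big]\,dL(r),\qquad t\in\mathbb{R}.$$ Since for each $t$ the integral is defined only up to a null set, $M_d$ denotes the version for which, $P$-a.s., for all $t\in\mathbb{R}$, $$M_d(t)=\frac{1}{\Gamma(d)}\int_{-\infty}^{\infty}\big[(t-r)_+^{d-1}-(-r)_+^{d-1}\big]L(r)\,dr .$$ *)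

theory Defs
  imports "HOL-Probability.Probability"
begin

definition cadlag :: "(real \<Rightarrow> real) \<Rightarrow> bool" where
  "cadlag f \<longleftrightarrow>
     (\<forall>t. (f \<longlongrightarrow> f t) (at_right t) \<and> (\<exists>l. (f \<longlongrightarrow> l) (at_left t)))"

text \<open>The starting value and the path regularity are only required almost surely.\<close>

locale two_sided_levy_process = prob_space M
  for M :: "'w measure" +
  fixes L :: "real \<Rightarrow> 'w \<Rightarrow> real"
  assumes random_variable_L: "\<And>t. random_variable borel (L t)"
    and L_zero: "AE \<omega> in M. L 0 \<omega> = 0"
    and cadlag_paths: "AE \<omega> in M. cadlag (\<lambda>t. L t \<omega>)"
    and independent_increments:
      "\<And>n (t :: nat \<Rightarrow> real). (\<And>i. i < n \<Longrightarrow> t i \<le> t (Suc i)) \<Longrightarrow>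
         indep_vars (\<lambda>_. borel) (\<lambda>i \<omega>. L (t (Suc i)) \<omega> - L (t i) \<omega>) {..<n}"
    and stationary_increments:
      "\<And>s t h. s \<le> t \<Longrightarrow>
         distr M borel (\<lambda>\<omega>. L (t + h) \<omega> - L (s + h) \<omega>) =
         distr M borel (\<lambda>\<omega>. L t \<omega> - L s \<omega>)"

definition levy_measure :: "real measure \<Rightarrow> bool" where
  "levy_measure \<nu> \<longleftrightarrow>
     sets \<nu> = sets borel \<and> emeasure \<nu> {0} = 0 \<and>
     (\<integral>\<^sup>+ x. ennreal (min 1 (x\<^sup>2)) \<partial>\<nu>) < \<infinity>"

text \<open>
  The Levy--Khintchine representation of an infinitely divisible law \<open>\<mu>\<close>, with drift \<open>\<gamma>\<close>
  (relative to truncation at \<open>\<bar>x\<bar> \<le> 1\<close>), Gaussian variance \<open>v\<close> and Levy measure \<open>\<nu>\<close>.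
\<close>

definition has_levy_triplet :: "real measure \<Rightarrow> real \<Rightarrow> real \<Rightarrow> real measure \<Rightarrow> bool" where
  "has_levy_triplet \<mu> \<gamma> v \<nu> \<longleftrightarrow>
     0 \<le> v \<and> levy_measure \<nu> \<and>
     (\<forall>u. char \<mu> u =
        exp (\<i> * of_real (\<gamma> * u) - of_real (v * u\<^sup>2 / 2) +
          (CLINT x|\<nu>. iexp (u * x) - 1 - \<i> * of_real (u * x * indicator {-1..1} x))))"

text \<open>
  The triplet of the law of \<open>L(1)\<close> is unique, so the following says that its Gaussian variance
  is \<open>0\<close>.
\<close>

definition no_brownian_component :: "'w measure \<Rightarrow> (real \<Rightarrow> 'w \<Rightarrow> real) \<Rightarrow> bool" where
  "no_brownian_component M L \<longleftrightarrow>
     (\<exists>\<gamma> \<nu>. has_levy_triplet (distr M borel (L 1)) \<gamma> 0 \<nu>)"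

definition step_fun :: "nat \<Rightarrow> (nat \<Rightarrow> real) \<Rightarrow> (nat \<Rightarrow> real) \<Rightarrow> real \<Rightarrow> real" where
  "step_fun n a s r = (\<Sum>i<n. a i * indicator {s i<..s (Suc i)} r)"

definition step_integral ::
    "(real \<Rightarrow> 'w \<Rightarrow> real) \<Rightarrow> nat \<Rightarrow> (nat \<Rightarrow> real) \<Rightarrow> (nat \<Rightarrow> real) \<Rightarrow> 'w \<Rightarrow> real" where
  "step_integral L n a s \<omega> = (\<Sum>i<n. a i * (L (s (Suc i)) \<omega> - L (s i) \<omega>))"

text \<open>
  \<open>has_levy_integral M L f Y\<close>: the random variable \<open>Y\<close> is a version of \<open>\<integral> f dL\<close>, where the
  integral of a deterministic square integrable \<open>f\<close> is the \<open>L\<^sup>2(P)\<close>-limit of the integrals of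
  step functions approximating \<open>f\<close> in \<open>L\<^sup>2(\<real>)\<close>. For centered square integrable \<open>L\<close> the limit does
  not depend on the approximating sequence, up to null sets, by the isometry
  \<open>E[(\<integral> g dL)\<^sup>2] = E[L(1)\<^sup>2] * \<integral> g\<^sup>2\<close>.
\<close>

definition has_levy_integral ::
    "'w measure \<Rightarrow> (real \<Rightarrow> 'w \<Rightarrow> real) \<Rightarrow> (real \<Rightarrow> real) \<Rightarrow> ('w \<Rightarrow> real) \<Rightarrow> bool" where
  "has_levy_integral M L f Y \<longleftrightarrow>
     f \<in> borel_measurable borel \<and> Y \<in> borel_measurable M \<and>
     (\<exists>(n :: nat \<Rightarrow> nat) (a :: nat \<Rightarrow> nat \<Rightarrow> real) (s :: nat \<Rightarrow> nat \<Rightarrow> real).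
        (\<forall>k. \<forall>i<n k. s k i \<le> s k (Suc i)) \<and>
        (\<lambda>k. \<integral>\<^sup>+ r. ennreal ((step_fun (n k) (a k) (s k) r - f r)\<^sup>2) \<partial>lborel) \<longlonglongrightarrow> 0 \<and>
        (\<lambda>k. \<integral>\<^sup>+ \<omega>. ennreal ((step_integral L (n k) (a k) (s k) \<omega> - Y \<omega>)\<^sup>2) \<partial>M) \<longlonglongrightarrow> 0)"

text \<open>
  Below, \<open>(x)\<^sub>+\<^sup>a\<close> is \<open>max 0 x powr a\<close>; since \<open>0 powr a = 0\<close> in HOL, this is \<open>0\<close> for \<open>x \<le> 0\<close> also
  when \<open>a < 0\<close>. The pathwise formula does not assume integrability: for almost every path and
  all \<open>t\<close> the integral converges absolutely because of the other conditions.
\<close>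

locale fractional_levy_process = two_sided_levy_process M L
  for M :: "'w measure" and L :: "real \<Rightarrow> 'w \<Rightarrow> real" +
  fixes d :: real and X :: "real \<Rightarrow> 'w \<Rightarrow> real"
  assumes d_bounds: "0 < d" "d < 1 / 2"
    and square_integrable: "integrable M (\<lambda>\<omega>. (L 1 \<omega>)\<^sup>2)"
    and centered: "expectation (L 1) = 0"
    and no_brownian: "no_brownian_component M L"
    and integral_representation:
      "\<And>t. has_levy_integral M L
         (\<lambda>r. 1 / Gamma (d + 1) * (max 0 (t - r) powr d - max 0 (- r) powr d)) (X t)"
    and pathwise_representation:
      "AE \<omega> in M. \<forall>t. X t \<omega> =
         1 / Gamma d *
         (LINT r|lborel. (max 0 (t - r) powr (d - 1) - max 0 (- r) powr (d - 1)) * L r \<omega>)"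

end

theory Submission
  imports Defs
begin

text \<open>
  The proof is pathwise, apart from one moment estimate. Write \<open>k\<^sub>t(r) = (t - r)\<^sub>+\<^sup>d\<^sup>-\<^sup>1\<close>, so that
  \<open>\<Gamma>(d) M\<^sub>d(t) = \<integral> (k\<^sub>t - k\<^sub>0) L dr\<close>. If these integrals converge absolutely, then
  \<open>\<Gamma>(d) (M\<^sub>d(b) - M\<^sub>d(a)) = \<integral> (k\<^sub>b - k\<^sub>a) L dr\<close>, and the increment splits into two parts.

  Near the end points, the cadlag path is bounded, whatever its jumps, and the \<open>L\<^sup>1\<close> norm of
  \<open>k\<^sub>b - k\<^sub>a\<close> is at most \<open>2 (b - a)\<^sup>d / d\<close>. This is where the order \<open>d\<close> comes from.
  Far to the left, the mean value theorem gives \<open>\<bar>k\<^sub>b(r) - k\<^sub>a(r)\<bar> \<le> (b - a) (a - r)\<^sup>d\<^sup>-\<^sup>2\<close>, so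
  this part is even Lipschitz, provided that \<open>(1 + \<bar>r\<bar>)\<^sup>d\<^sup>-\<^sup>2 L(r)\<close> is integrable. Both parts together
  are \<open>frac_integral_increment\<close>, from which \<open>frac_integral_pointwise_Hoelder\<close> follows for every
  locally bounded function with this integrability.

  Almost every path has this integrability (\<open>AE_weighted_path_integrable\<close>): a centered square
  integrable process with stationary independent increments satisfies
  \<open>E\<bar>L(r)\<bar> = O((1 + \<bar>r\<bar>)\<^sup>1\<^sup>/\<^sup>2)\<close>, and \<open>d - 2 + 1/2 < -1\<close> since \<open>d < 1/2\<close>. The exceptional null set does
  not depend on \<open>t\<close>, because neither integrability nor local boundedness of the path does.
\<close>

section \<open>Increments of the fractional kernel\<close>

text \<open>
  Up to the factor \<open>1 / \<Gamma>(d)\<close> this is the kernel of the fractional integral of order \<open>d\<close>. For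
  \<open>r \<ge> t\<close> it vanishes, also when the exponent is negative, because \<open>0 powr a = 0\<close>.
\<close>

definition frac_kernel :: "real \<Rightarrow> real \<Rightarrow> real \<Rightarrow> real" where
  "frac_kernel d t r = max 0 (t - r) powr (d - 1)"

lemma frac_kernel_measurable [measurable]: "frac_kernel d t \<in> borel_measurable borel"
  unfolding frac_kernel_def by measurable

lemma frac_kernel_nonneg: "0 \<le> frac_kernel d t r"
  by (simp add: frac_kernel_def)

lemma frac_kernel_eq_0: "t \<le> r \<Longrightarrow> frac_kernel d t r = 0"
  by (simp add: frac_kernel_def)

lemma has_bochner_integral_frac_kernel:
  assumes "0 < d" "c \<le> t"
  shows "has_bochner_integral lborel (\<lambda>r. indicator {c..} r * frac_kernel d t r)
           ((t - c) powr d / d)"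
proof -
  have "((\<lambda>x. x powr (d - 1)) has_integral ((t - c) powr d / d)) {0..t - c}"
    using has_integral_powr_from_0[of "d - 1" "t - c"] assms by simp
  then have "(\<integral>\<^sup>+x. ennreal (indicator {0..t - c} x * x powr (d - 1)) \<partial>lborel)
      = ennreal ((t - c) powr d / d)"
    by (intro nn_integral_has_integral_lebesgue) auto
  then have "has_bochner_integral lborel (\<lambda>x. indicator {0..t - c} x * x powr (d - 1))
      ((t - c) powr d / d)"
    using assms by (intro has_bochner_integral_nn_integral) auto
  then have "has_bochner_integral lborel
      (\<lambda>r. indicator {0..t - c} (t + -1 * r) * (t + -1 * r) powr (d - 1)) ((t - c) powr d / d)"
    by (subst (asm) lborel_has_bochner_integral_real_affine_iff[where c="-1" and t=t]) simp_all
  also have "(\<lambda>r. indicator {0..t - c} (t + -1 * r) * (t + -1 * r) powr (d - 1))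
      = (\<lambda>r. indicator {c..} r * frac_kernel d t r)"
    by (auto simp: fun_eq_iff indicator_def frac_kernel_def max_def)
  finally show ?thesis .
qed

text \<open>
  The order \<open>d\<close> originates here. On \<open>[c, a)\<close> the kernel decreases when its end point moves from \<open>a\<close>
  to \<open>b\<close>, and on \<open>[a, b]\<close> only the kernel of \<open>b\<close> is present, so the absolute value can be resolved and
  the integral is \<open>((a - c)\<^sup>d - (b - c)\<^sup>d + 2 (b - a)\<^sup>d) / d\<close>. The difference of the first two
  terms is not positive, which leaves a bound independent of the distance to \<open>c\<close>.
\<close>

lemma frac_kernel_increment_near:
  assumes "0 < d" "d \<le> 1" "c \<le> a" "a \<le> b"
  shows "integrable lborel (\<lambda>r. indicator {c..} r * \<bar>frac_kernel d b r - frac_kernel d a r\<bar>)"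
    and "(LINT r|lborel. indicator {c..} r * \<bar>frac_kernel d b r - frac_kernel d a r\<bar>)
           \<le> 2 / d * (b - a) powr d"
proof -
  have mono: "frac_kernel d b r \<le> frac_kernel d a r" if "r < a" for r
    using that assms by (auto simp: frac_kernel_def intro!: powr_mono2')
  have "has_bochner_integral lborel
      (\<lambda>r. indicator {c..} r * frac_kernel d a r - indicator {c..} r * frac_kernel d b r
           + 2 * (indicator {a..} r * frac_kernel d b r))
      ((a - c) powr d / d - (b - c) powr d / d + 2 * ((b - a) powr d / d))"
    using assms by (intro has_bochner_integral_add has_bochner_integral_diff
      has_bochner_integral_mult_right has_bochner_integral_frac_kernel) auto
  also have "(\<lambda>r. indicator {c..} r * frac_kernel d a r - indicator {c..} r * frac_kernel d b r
           + 2 * (indicator {a..} r * frac_kernel d b r))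
      = (\<lambda>r. indicator {c..} r * \<bar>frac_kernel d b r - frac_kernel d a r\<bar>)" (is "?l = ?r")
  proof
    fix r show "?l r = ?r r"
      using mono[of r] assms frac_kernel_nonneg[of d b r] frac_kernel_eq_0[of a r d]
      by (cases "r < a") (auto simp: indicator_def)
  qed
  finally have *: "has_bochner_integral lborel
      (\<lambda>r. indicator {c..} r * \<bar>frac_kernel d b r - frac_kernel d a r\<bar>)
      ((a - c) powr d / d - (b - c) powr d / d + 2 * ((b - a) powr d / d))" .
  then show "integrable lborel (\<lambda>r. indicator {c..} r * \<bar>frac_kernel d b r - frac_kernel d a r\<bar>)"
    by (simp add: has_bochner_integral_iff)
  have "(a - c) powr d / d \<le> (b - c) powr d / d"
    using assms by (intro divide_right_mono powr_mono2) auto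
  with * show "(LINT r|lborel. indicator {c..} r * \<bar>frac_kernel d b r - frac_kernel d a r\<bar>)
           \<le> 2 / d * (b - a) powr d"
    by (simp add: has_bochner_integral_iff)
qed

text \<open>
  Away from its singularity the kernel is differentiable in the end point, so the mean value theorem
  gives a first order bound, which is better than order \<open>d\<close>.
\<close>

lemma frac_kernel_increment_far:
  assumes "0 < d" "d \<le> 1" "r < a" "a \<le> b"
  shows "\<bar>frac_kernel d b r - frac_kernel d a r\<bar> \<le> (b - a) * (a - r) powr (d - 2)"
proof (cases "a = b")
  case False
  with assms have "a - r < b - r" by simp
  then have "\<exists>z>a - r. z < b - r \<and>
      (b - r) powr (d - 1) - (a - r) powr (d - 1) = (b - r - (a - r)) * ((d - 1) * z powr (d - 1 - 1))"
    using assms by (intro MVT2) (auto intro!: derivative_eq_intros)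
  then obtain z where z: "a - r < z" "(b - r) powr (d - 1) - (a - r) powr (d - 1)
      = (b - a) * ((d - 1) * z powr (d - 2))"
    by (auto simp: algebra_simps)
  have "z powr (d - 2) \<le> (a - r) powr (d - 2)"
    using assms z by (intro powr_mono2') auto
  then have "(1 - d) * z powr (d - 2) \<le> 1 * (a - r) powr (d - 2)"
    using assms by (intro mult_mono) auto
  then have "(b - a) * ((1 - d) * z powr (d - 2)) \<le> (b - a) * (a - r) powr (d - 2)"
    using assms by (intro mult_left_mono) auto
  with z assms show ?thesis
    by (simp add: frac_kernel_def abs_mult)
qed auto

text \<open>
  This replaces the decay rate \<open>a - r\<close>, measured from the end point, by a weight that is the same for
  all end points; only the constant depends on \<open>a\<close>.
\<close>

lemma powr_far_le_weight:
  fixes a r p :: real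
  assumes "p \<le> 0" "r \<le> a - 1"
  shows "(a - r) powr p \<le> (2 + \<bar>a\<bar>) powr (- p) * (1 + \<bar>r\<bar>) powr p"
proof -
  have "1 * (1 + \<bar>a\<bar>) \<le> (a - r) * (1 + \<bar>a\<bar>)"
    using assms by (intro mult_right_mono) auto
  then have "1 + \<bar>r\<bar> \<le> (2 + \<bar>a\<bar>) * (a - r)"
    using assms by (simp add: algebra_simps)
  then have "((2 + \<bar>a\<bar>) * (a - r)) powr p \<le> (1 + \<bar>r\<bar>) powr p"
    using assms by (intro powr_mono2') auto
  then have "(2 + \<bar>a\<bar>) powr (- p) * ((2 + \<bar>a\<bar>) powr p * (a - r) powr p)
      \<le> (2 + \<bar>a\<bar>) powr (- p) * (1 + \<bar>r\<bar>) powr p"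
    using assms by (intro mult_left_mono) (auto simp: powr_mult)
  moreover have "2 + \<bar>a\<bar> \<noteq> 0"
    by linarith
  ultimately show ?thesis
    by (simp add: mult.assoc[symmetric] powr_add[symmetric])
qed

section \<open>Fractional integrals of a fixed path\<close>

text \<open>
  The line is cut at \<open>a - 1\<close>. Between the cut and \<open>b\<close>, beyond which both kernels vanish, \<open>g\<close> is bounded
  and the \<open>L\<^sup>1\<close> norm of the kernel increment counts. To the left of the cut the kernel increment is at
  most a constant times \<open>b - a\<close> times the weight.
\<close>

lemma frac_integral_increment:
  assumes d: "0 < d" "d \<le> 1" and ab: "a \<le> b"
    and [measurable]: "g \<in> borel_measurable borel"
    and weighted: "integrable lborel (\<lambda>r. (1 + \<bar>r\<bar>) powr (d - 2) * g r)"
    and K: "\<And>r. a - 1 \<le> r \<Longrightarrow> r \<le> b \<Longrightarrow> \<bar>g r\<bar> \<le> K"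
  shows "integrable lborel (\<lambda>r. (frac_kernel d b r - frac_kernel d a r) * g r)"
    and "\<bar>LINT r|lborel. (frac_kernel d b r - frac_kernel d a r) * g r\<bar>
       \<le> K * (2 / d * (b - a) powr d) +
         (b - a) * (2 + \<bar>a\<bar>) powr (2 - d) * (LINT r|lborel. (1 + \<bar>r\<bar>) powr (d - 2) * \<bar>g r\<bar>)"
proof -
  let ?w = "\<lambda>r::real. (1 + \<bar>r\<bar>) powr (d - 2)"
  let ?near = "\<lambda>r. indicator {a - 1..} r * \<bar>frac_kernel d b r - frac_kernel d a r\<bar>"
  let ?dom = "\<lambda>r. K * ?near r + (b - a) * (2 + \<bar>a\<bar>) powr (2 - d) * (?w r * \<bar>g r\<bar>)"
  have K0: "0 \<le> K"
    using K[of a] ab by auto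
  have near: "integrable lborel ?near" "(LINT r|lborel. ?near r) \<le> 2 / d * (b - a) powr d"
    using d ab by (intro frac_kernel_increment_near; simp)+
  have w: "integrable lborel (\<lambda>r. ?w r * \<bar>g r\<bar>)"
    using integrable_norm[OF weighted] by (simp add: abs_mult)
  have dom: "integrable lborel ?dom"
    using near w by auto
  have bound: "norm ((frac_kernel d b r - frac_kernel d a r) * g r) \<le> ?dom r" for r
  proof (cases "a - 1 \<le> r")
    case True
    have "\<bar>frac_kernel d b r - frac_kernel d a r\<bar> * \<bar>g r\<bar> \<le> K * ?near r"
    proof (cases "r \<le> b")
      case True
      then show ?thesis
        using mult_right_mono[OF K[of r], of "\<bar>frac_kernel d b r - frac_kernel d a r\<bar>"]
          \<open>a - 1 \<le> r\<close> by (simp add: mult.commute)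
    qed (use ab K0 in \<open>simp add: frac_kernel_eq_0\<close>)
    then show ?thesis
      using ab by (simp add: abs_mult add_increasing2)
  next
    case False
    then have "\<bar>frac_kernel d b r - frac_kernel d a r\<bar> \<le> (b - a) * (a - r) powr (d - 2)"
      using d ab by (intro frac_kernel_increment_far) auto
    also have "\<dots> \<le> (b - a) * ((2 + \<bar>a\<bar>) powr (2 - d) * ?w r)"
      using powr_far_le_weight[of "d - 2" r a] d ab False by (intro mult_left_mono) auto
    finally have "\<bar>frac_kernel d b r - frac_kernel d a r\<bar> * \<bar>g r\<bar>
        \<le> (b - a) * ((2 + \<bar>a\<bar>) powr (2 - d) * ?w r) * \<bar>g r\<bar>"
      by (rule mult_right_mono) simp
    then show ?thesis
      using False by (simp add: abs_mult mult.assoc)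
  qed
  show int: "integrable lborel (\<lambda>r. (frac_kernel d b r - frac_kernel d a r) * g r)"
    by (rule Bochner_Integration.integrable_bound[OF dom])
      (auto intro!: always_eventually order_trans[OF bound[unfolded real_norm_def]])
  have "\<bar>LINT r|lborel. (frac_kernel d b r - frac_kernel d a r) * g r\<bar> \<le> (LINT r|lborel. ?dom r)"
    using Bochner_Integration.integral_norm_bound_integral[OF int dom] bound by simp
  also have "\<dots> = K * (LINT r|lborel. ?near r) +
      (b - a) * (2 + \<bar>a\<bar>) powr (2 - d) * (LINT r|lborel. ?w r * \<bar>g r\<bar>)"
    using near w by simp
  also have "\<dots> \<le> K * (2 / d * (b - a) powr d) +
      (b - a) * (2 + \<bar>a\<bar>) powr (2 - d) * (LINT r|lborel. ?w r * \<bar>g r\<bar>)"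
    using near K0 by (intro add_right_mono mult_left_mono) auto
  finally show "\<bar>LINT r|lborel. (frac_kernel d b r - frac_kernel d a r) * g r\<bar>
       \<le> K * (2 / d * (b - a) powr d) +
         (b - a) * (2 + \<bar>a\<bar>) powr (2 - d) * (LINT r|lborel. (1 + \<bar>r\<bar>) powr (d - 2) * \<bar>g r\<bar>)" .
qed

text \<open>
  The two contributions are of order \<open>d\<close> and of order \<open>1\<close> in the length of the increment, and for
  lengths below \<open>1\<close> the former dominates. Both signs of \<open>\<delta>\<close> are treated at once by bounding the
  increments over all intervals with an end point at \<open>t\<close>, so the constant must also be uniform in the
  left end point.
\<close>

lemma frac_integral_pointwise_Hoelder:
  fixes t :: real
  assumes d: "0 < d" "d \<le> 1"
    and g [measurable]: "g \<in> borel_measurable borel"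
    and weighted: "integrable lborel (\<lambda>r. (1 + \<bar>r\<bar>) powr (d - 2) * g r)"
    and bdd: "\<And>a b. bounded (g ` {a..b})"
  defines "F \<equiv> \<lambda>t. LINT r|lborel. (frac_kernel d t r - frac_kernel d 0 r) * g r"
  obtains C where "\<And>\<delta>. \<bar>\<delta>\<bar> < 1 \<Longrightarrow> \<bar>F (t + \<delta>) - F t\<bar> \<le> C * \<bar>\<delta>\<bar> powr d"
proof -
  let ?k = "frac_kernel d"
  let ?I = "LINT r|lborel. (1 + \<bar>r\<bar>) powr (d - 2) * \<bar>g r\<bar>"
  have incr_int: "integrable lborel (\<lambda>r. (?k b r - ?k a r) * g r)" if "a \<le> b" for a b
  proof -
    obtain K where "\<forall>r\<in>{a - 1..b}. \<bar>g r\<bar> \<le> K"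
      using bdd[of "a - 1" b] by (auto simp: bounded_iff)
    with that show ?thesis
      by (intro frac_integral_increment[OF d _ g weighted]) auto
  qed
  have F_int: "integrable lborel (\<lambda>r. (?k s r - ?k 0 r) * g r)" for s
  proof (cases "0 \<le> s")
    case False
    then have "integrable lborel (\<lambda>r. - ((?k 0 r - ?k s r) * g r))"
      by (intro integrable_minus incr_int) auto
    then show ?thesis
      by (simp add: algebra_simps)
  qed (rule incr_int)
  have F_diff: "F b - F a = (LINT r|lborel. (?k b r - ?k a r) * g r)" for a b
    unfolding F_def Bochner_Integration.integral_diff[OF F_int F_int, symmetric]
    by (simp add: algebra_simps)
  \<comment> \<open>The left end points range over \<open>[t - 1, t]\<close>, and the near part reaches \<open>1\<close> further left.\<close>
  obtain K where K: "\<forall>r\<in>{t - 2..t + 1}. \<bar>g r\<bar> \<le> K"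
    using bdd[of "t - 2" "t + 1"] by (auto simp: bounded_iff)
  define C where "C = K * (2 / d) + (3 + \<bar>t\<bar>) powr (2 - d) * ?I"
  have I0: "0 \<le> ?I"
    by simp
  have main: "\<bar>F b - F a\<bar> \<le> C * (b - a) powr d"
    if ab: "a \<le> b" "b - a \<le> 1" "t - 1 \<le> a" "a \<le> t" "b \<le> t + 1" for a b
  proof -
    have "\<bar>F b - F a\<bar> \<le> K * (2 / d * (b - a) powr d) + (b - a) * (2 + \<bar>a\<bar>) powr (2 - d) * ?I"
      unfolding F_diff using ab K by (intro frac_integral_increment(2)[OF d _ g weighted]) auto
    also have "(b - a) * (2 + \<bar>a\<bar>) powr (2 - d) * ?I
        \<le> (b - a) powr d * (3 + \<bar>t\<bar>) powr (2 - d) * ?I"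
    proof (intro mult_right_mono mult_mono I0)
      show "b - a \<le> (b - a) powr d"
        using powr_mono'[of d 1 "b - a"] d ab by (cases "a = b") auto
      show "(2 + \<bar>a\<bar>) powr (2 - d) \<le> (3 + \<bar>t\<bar>) powr (2 - d)"
        using ab d by (intro powr_mono2) auto
    qed auto
    finally show ?thesis
      by (simp add: C_def algebra_simps)
  qed
  show ?thesis
  proof (rule that)
    fix \<delta> :: real assume "\<bar>\<delta>\<bar> < 1"
    then show "\<bar>F (t + \<delta>) - F t\<bar> \<le> C * \<bar>\<delta>\<bar> powr d"
      using main[of t "t + \<delta>"] main[of "t + \<delta>" t]
      by (cases "0 \<le> \<delta>") (auto simp: abs_minus_commute)
  qed
qed

section \<open>Cadlag functions and their values on grids\<close>

text \<open>
  The one-sided limits bound \<open>f\<close> on a punctured neighbourhood of each point, and the Bolzano bisection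
  principle glues these local bounds together.
\<close>

lemma cadlag_bounded:
  assumes "cadlag f"
  shows "bounded (f ` {a..b})"
proof (cases "a \<le> b")
  case True
  then show ?thesis
  proof (induction rule: Bolzano)
    case (trans a b c)
    then show ?case
      using bounded_Un[of "f ` {a..b}" "f ` {b..c}"] ivl_disj_un_two_touch(4)[of a b c]
      by (simp add: image_Un[symmetric])
  next
    case (local x)
    obtain l where "(f \<longlongrightarrow> l) (at_left x)" "(f \<longlongrightarrow> f x) (at_right x)"
      using assms unfolding cadlag_def by blast
    then have "eventually (\<lambda>y. f y \<in> ball l 1) (at_left x)"
      "eventually (\<lambda>y. f y \<in> ball (f x) 1) (at_right x)"
      by (auto intro: topological_tendstoD simp del: mem_ball)
    then obtain u v where uv: "u < x" "\<And>y. u < y \<Longrightarrow> y < x \<Longrightarrow> f y \<in> ball l 1"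
      "x < v" "\<And>y. x < y \<Longrightarrow> y < v \<Longrightarrow> f y \<in> ball (f x) 1"
      unfolding eventually_at_left_field eventually_at_right_field by blast
    have near: "f y \<in> ball l 1 \<union> ball (f x) 1" if "u < y" "y < v" for y
      using uv that by (cases y x rule: linorder_cases) auto
    have bdd: "bounded (f ` {a..b})" if "u < a" "b < v" for a b
    proof (rule bounded_subset)
      show "f ` {a..b} \<subseteq> ball l 1 \<union> ball (f x) 1"
        using that by (intro image_subsetI near) auto
    qed simp
    show ?case
      using uv by (intro exI[of _ "min (x - u) (v - x)"]) (auto intro!: bdd)
  qed
qed simp

text \<open>
  The least multiple of \<open>1 / (n + 1)\<close> that lies strictly above \<open>r\<close>. These points approach \<open>r\<close> from the
  right, so a right-continuous function is recovered from its values on the grids. The grids are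
  countable, which gives measurability, and consist of rational numbers, at which the moments of
  \<open>L\<close> can be computed from those of \<open>L 1\<close>.
\<close>

definition grid_above :: "nat \<Rightarrow> real \<Rightarrow> real" where
  "grid_above n r = real_of_int (\<lfloor>real (Suc n) * r\<rfloor> + 1) / real (Suc n)"

lemma grid_above_bounds: "r < grid_above n r" "grid_above n r \<le> r + 1 / real (Suc n)"
proof -
  have "real (Suc n) * r < real_of_int (\<lfloor>real (Suc n) * r\<rfloor> + 1)"
    "real_of_int (\<lfloor>real (Suc n) * r\<rfloor> + 1) \<le> real (Suc n) * r + 1"
    by linarith+
  then have "real (Suc n) * r / real (Suc n) < grid_above n r"
    "grid_above n r \<le> (real (Suc n) * r + 1) / real (Suc n)"
    unfolding grid_above_def by (intro divide_strict_right_mono divide_right_mono; simp)+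
  then show "r < grid_above n r" "grid_above n r \<le> r + 1 / real (Suc n)"
    by (simp_all add: add_divide_distrib)
qed

lemma grid_above_tendsto: "filterlim (\<lambda>n. grid_above n r) (at_right r) sequentially"
proof (rule tendsto_imp_filterlim_at_right)
  have "(\<lambda>n. r + 1 / real (Suc n)) \<longlonglongrightarrow> r + 0"
    by (intro tendsto_add tendsto_const LIMSEQ_Suc[OF lim_1_over_n])
  then have lim: "(\<lambda>n. r + 1 / real (Suc n)) \<longlonglongrightarrow> r"
    by simp
  show "(\<lambda>n. grid_above n r) \<longlonglongrightarrow> r"
    by (rule tendsto_sandwich[OF _ _ tendsto_const lim];
        intro always_eventually allI grid_above_bounds(2) less_imp_le[OF grid_above_bounds(1)])
qed (simp add: grid_above_bounds)

lemma cadlag_grid_above: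
  assumes "cadlag f"
  shows "(\<lambda>n. f (grid_above n r)) \<longlonglongrightarrow> f r"
  using filterlim_compose[OF _ grid_above_tendsto] assms unfolding cadlag_def by blast

text \<open>
  The time at which \<open>H\<close> is evaluated may depend on the point \<open>x\<close>; this serves both a single path and
  the joint measurability of a process in time and outcome.
\<close>

lemma borel_measurable_grid_above:
  fixes H :: "real \<Rightarrow> 'a \<Rightarrow> real"
  assumes "\<And>t. H t \<in> borel_measurable N" and \<phi> [measurable]: "\<phi> \<in> borel_measurable N"
  shows "(\<lambda>x. H (grid_above n (\<phi> x)) x) \<in> borel_measurable N"
proof -
  have "(\<lambda>x. \<lfloor>real (Suc n) * \<phi> x\<rfloor>) \<in> N \<rightarrow>\<^sub>M count_space UNIV"
    by measurable
  with assms(1) show ?thesis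
    unfolding grid_above_def
    by (rule measurable_compose_countable[where f="\<lambda>k. H (real_of_int (k + 1) / real (Suc n))"])
qed

lemma cadlag_borel_measurable:
  assumes "cadlag f"
  shows "f \<in> borel_measurable borel"
proof (rule borel_measurable_LIMSEQ_real)
  show "(\<lambda>r. f (grid_above n r)) \<in> borel_measurable borel" for n
    by (rule borel_measurable_grid_above) auto
qed (rule cadlag_grid_above[OF assms])

section \<open>Moments of the Levy process at rational times\<close>

text \<open>
  By independence and Fubini's theorem, \<open>(X + y)\<^sup>2\<close> is integrable for almost every value \<open>y\<close> of \<open>Y\<close>. One
  such constant \<open>y\<close> suffices.
\<close>

lemma (in prob_space) indep_summand_square_integrable:
  fixes X Y :: "'a \<Rightarrow> real"
  assumes indep: "indep_var borel X borel Y"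
    and sum: "integrable M (\<lambda>\<omega>. (X \<omega> + Y \<omega>)\<^sup>2)"
  shows "integrable M (\<lambda>\<omega>. (X \<omega>)\<^sup>2)"
proof -
  have [measurable]: "X \<in> borel_measurable M" "Y \<in> borel_measurable M"
    using indep indep_var_rv1 indep_var_rv2 by auto
  interpret X: prob_space "distr M borel X"
    by (rule prob_space_distr) simp
  interpret Y: prob_space "distr M borel Y"
    by (rule prob_space_distr) simp
  interpret XY: pair_prob_space "distr M borel X" "distr M borel Y" ..
  have "distr M borel X \<Otimes>\<^sub>M distr M borel Y = distr M (borel \<Otimes>\<^sub>M borel) (\<lambda>\<omega>. (X \<omega>, Y \<omega>))"
    using indep by (simp add: indep_var_distribution_eq)
  with sum have "integrable (distr M borel X \<Otimes>\<^sub>M distr M borel Y) (\<lambda>(x, y). (x + y)\<^sup>2)"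
    by (simp add: integrable_distr_eq)
  then have "AE y in distr M borel Y. integrable (distr M borel X) (\<lambda>x. (x + y)\<^sup>2)"
    by (rule XY.AE_integrable_snd)
  then obtain y where y: "integrable (distr M borel X) (\<lambda>x. (x + y)\<^sup>2)"
    using eventually_happens'[OF Y.ae_filter_bot] by blast
  have "integrable M (\<lambda>\<omega>. (X \<omega> + y)\<^sup>2)"
    using y by (simp add: integrable_distr_eq)
  then have "integrable M (\<lambda>\<omega>. 2 * (X \<omega> + y)\<^sup>2 + 2 * y\<^sup>2)"
    by simp
  moreover have "(X \<omega>)\<^sup>2 \<le> 2 * (X \<omega> + y)\<^sup>2 + 2 * y\<^sup>2" for \<omega>
    using zero_le_power2[of "X \<omega> + 2 * y"] by (simp add: power2_eq_square algebra_simps)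
  ultimately show ?thesis
    by (elim Bochner_Integration.integrable_bound) auto
qed

text \<open>
  Bienayme's identity for centered variables: the mixed terms of the square vanish.
\<close>

lemma (in prob_space) expectation_square_indep_sum:
  fixes X :: "'i \<Rightarrow> 'a \<Rightarrow> real"
  assumes "finite I" "indep_vars (\<lambda>_. borel) X I"
    and "\<And>i. i \<in> I \<Longrightarrow> integrable M (\<lambda>\<omega>. (X i \<omega>)\<^sup>2)"
    and "\<And>i. i \<in> I \<Longrightarrow> expectation (X i) = 0"
  shows "integrable M (\<lambda>\<omega>. (\<Sum>i\<in>I. X i \<omega>)\<^sup>2) \<and>
    expectation (\<lambda>\<omega>. (\<Sum>i\<in>I. X i \<omega>)\<^sup>2) = (\<Sum>i\<in>I. expectation (\<lambda>\<omega>. (X i \<omega>)\<^sup>2))"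
  using assms
proof (induction I rule: finite_induct)
  case (insert j I)
  let ?S = "\<lambda>\<omega>. \<Sum>i\<in>I. X i \<omega>"
  have IH: "integrable M (\<lambda>\<omega>. (?S \<omega>)\<^sup>2)"
    "expectation (\<lambda>\<omega>. (?S \<omega>)\<^sup>2) = (\<Sum>i\<in>I. expectation (\<lambda>\<omega>. (X i \<omega>)\<^sup>2))"
    using insert.IH indep_vars_subset[OF insert.prems(1)] insert.prems by auto
  have indep: "indep_var borel (X j) borel ?S"
    using insert by (intro indep_vars_sum) auto
  have [measurable]: "X j \<in> borel_measurable M" "?S \<in> borel_measurable M"
    using indep indep_var_rv1 indep_var_rv2 by auto
  have Xj: "integrable M (\<lambda>\<omega>. (X j \<omega>)\<^sup>2)"
    using insert.prems by simp
  have int: "integrable M (X j)" "integrable M ?S"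
    using Xj IH(1) by (auto intro: square_integrable_imp_integrable)
  have prod: "integrable M (\<lambda>\<omega>. X j \<omega> * ?S \<omega>)" "expectation (\<lambda>\<omega>. X j \<omega> * ?S \<omega>) = 0"
    using indep_var_integrable[OF indep int] indep_var_lebesgue_integral[OF indep int]
      insert.prems(3) by auto
  have "(\<Sum>i\<in>insert j I. X i \<omega>)\<^sup>2 = (X j \<omega>)\<^sup>2 + 2 * (X j \<omega> * ?S \<omega>) + (?S \<omega>)\<^sup>2" for \<omega>
    using insert.hyps by (simp add: power2_sum)
  with insert.hyps Xj IH prod show ?case
    by simp
qed simp

context two_sided_levy_process
begin

lemma increment_same_distr:
  assumes "0 \<le> h"
  shows "distr M borel (\<lambda>\<omega>. L (s + h) \<omega> - L s \<omega>) = distr M borel (\<lambda>\<omega>. L h \<omega> - L 0 \<omega>)"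
  using stationary_increments[of 0 h s] assms by (simp add: add.commute)

lemma increment_integrable_iff:
  fixes f :: "real \<Rightarrow> real"
  assumes "0 \<le> h" and [measurable]: "f \<in> borel_measurable borel"
  shows "integrable M (\<lambda>\<omega>. f (L (s + h) \<omega> - L s \<omega>)) \<longleftrightarrow> integrable M (\<lambda>\<omega>. f (L h \<omega> - L 0 \<omega>))"
proof -
  note [measurable] = random_variable_L
  show ?thesis
    using increment_same_distr[OF assms(1), of s]
      integrable_distr_eq[of "\<lambda>\<omega>. L (s + h) \<omega> - L s \<omega>" M borel f]
      integrable_distr_eq[of "\<lambda>\<omega>. L h \<omega> - L 0 \<omega>" M borel f] by simp
qed

lemma increment_expectation:
  fixes f :: "real \<Rightarrow> real"
  assumes "0 \<le> h" and [measurable]: "f \<in> borel_measurable borel"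
  shows "expectation (\<lambda>\<omega>. f (L (s + h) \<omega> - L s \<omega>)) = expectation (\<lambda>\<omega>. f (L h \<omega> - L 0 \<omega>))"
proof -
  note [measurable] = random_variable_L
  show ?thesis
    using increment_same_distr[OF assms(1), of s]
      integral_distr[of "\<lambda>\<omega>. L (s + h) \<omega> - L s \<omega>" M borel f]
      integral_distr[of "\<lambda>\<omega>. L h \<omega> - L 0 \<omega>" M borel f] by simp
qed

text \<open>
  The interval \<open>[0, 1]\<close> is divided into \<open>m\<close> equal parts. The increments over the parts are independent and
  equally distributed, so each inherits square integrability, mean zero and one \<open>m\<close>-th of
  the variance from \<open>L 1\<close>; \<open>k\<close> of them add up to an increment over a length \<open>k / m\<close>. For irrational lengths
  this argument is not available, and Fatou's lemma takes its place later.
\<close>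

lemma second_moment_rational_increment:
  assumes sq: "integrable M (\<lambda>\<omega>. (L 1 \<omega>)\<^sup>2)" and mean: "expectation (L 1) = 0"
    and m: "0 < m"
  shows "integrable M (\<lambda>\<omega>. (L (s + real k / real m) \<omega> - L s \<omega>)\<^sup>2)"
    and "expectation (\<lambda>\<omega>. (L (s + real k / real m) \<omega> - L s \<omega>)\<^sup>2)
           = real k / real m * expectation (\<lambda>\<omega>. (L 1 \<omega>)\<^sup>2)"
proof -
  note [measurable] = random_variable_L
  define h where "h = 1 / real m"
  have h: "0 \<le> h" "real m * h = 1" "real k * h = real k / real m"
    using m by (auto simp: h_def)
  define D where "D i \<omega> = L (real (Suc i) * h) \<omega> - L (real i * h) \<omega>" for i \<omega>
  have D_shift: "D i \<omega> = L (real i * h + h) \<omega> - L (real i * h) \<omega>" for i \<omega>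
    by (simp add: D_def algebra_simps)
  have D_sum: "(\<Sum>i<n. D i \<omega>) = L (real n * h) \<omega> - L 0 \<omega>" for n \<omega>
    unfolding D_def using sum_lessThan_telescope[of "\<lambda>i. L (real i * h) \<omega>" n] by simp
  have indep: "indep_vars (\<lambda>_. borel) D {..<n}" for n
    unfolding D_def
    using independent_increments[of n "\<lambda>i. real i * h"] h by (simp add: mult_right_mono)
  have D_meas [measurable]: "D i \<in> borel_measurable M" for i
    unfolding D_def by measurable
  have L1_AE: "AE \<omega> in M. L 1 \<omega> = L 1 \<omega> - L 0 \<omega>"
    using L_zero by auto
  have L1_sq_AE: "AE \<omega> in M. (L 1 \<omega>)\<^sup>2 = (L 1 \<omega> - L 0 \<omega>)\<^sup>2"
    using L_zero by auto
  have sq1: "integrable M (\<lambda>\<omega>. (L 1 \<omega> - L 0 \<omega>)\<^sup>2)"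
    using sq by (subst integrable_cong_AE[OF _ _ L1_sq_AE, symmetric]) auto
  have D_sum_m: "(\<Sum>i<m. D i \<omega>) = L 1 \<omega> - L 0 \<omega>" for \<omega>
    using h by (simp add: D_sum)
  \<comment> \<open>Splitting off one increment shows that it is square integrable.\<close>
  have rest: "D 0 \<omega> + (\<Sum>i\<in>{..<m} - {0}. D i \<omega>) = L 1 \<omega> - L 0 \<omega>" for \<omega>
    using m by (simp add: D_sum_m[symmetric] sum.remove[of "{..<m}" 0])
  have "indep_var borel (D 0) borel (\<lambda>\<omega>. \<Sum>i\<in>{..<m} - {0}. D i \<omega>)"
    using indep[of m] m by (intro indep_vars_sum) (auto simp: insert_absorb)
  then have "integrable M (\<lambda>\<omega>. (D 0 \<omega>)\<^sup>2)"
    by (rule indep_summand_square_integrable) (use sq1 rest in simp)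
  then have D_sq: "integrable M (\<lambda>\<omega>. (D i \<omega>)\<^sup>2)" for i
    using increment_integrable_iff[of h "\<lambda>x. x\<^sup>2" "real i * h"] h by (simp add: D_shift)
  have D_int: "integrable M (D i)" for i
    using D_sq by (rule square_integrable_imp_integrable[rotated]) simp
  define \<mu> where "\<mu> = expectation (\<lambda>\<omega>. L h \<omega> - L 0 \<omega>)"
  define v where "v = expectation (\<lambda>\<omega>. (L h \<omega> - L 0 \<omega>)\<^sup>2)"
  have D_mean: "expectation (D i) = \<mu>" for i
    using increment_expectation[of h "\<lambda>x. x" "real i * h"] h by (simp add: D_shift[abs_def] \<mu>_def)
  have D_second: "expectation (\<lambda>\<omega>. (D i \<omega>)\<^sup>2) = v" for i
    using increment_expectation[of h "\<lambda>x. x\<^sup>2" "real i * h"] h by (simp add: D_shift v_def)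
  have "expectation (L 1) = expectation (\<lambda>\<omega>. L 1 \<omega> - L 0 \<omega>)"
    by (rule integral_cong_AE[OF _ _ L1_AE]) auto
  also have "\<dots> = expectation (\<lambda>\<omega>. \<Sum>i<m. D i \<omega>)"
    by (simp add: D_sum_m)
  also have "\<dots> = real m * \<mu>"
    using D_int by (simp add: D_mean)
  finally have D_centered: "expectation (D i) = 0" for i
    using m mean D_mean[of i] by simp
  have sums: "integrable M (\<lambda>\<omega>. (L (real n * h) \<omega> - L 0 \<omega>)\<^sup>2)"
    "expectation (\<lambda>\<omega>. (L (real n * h) \<omega> - L 0 \<omega>)\<^sup>2) = real n * v" for n
    using expectation_square_indep_sum[OF _ indep[of n]] D_sq D_centered
    by (simp_all add: D_sum D_second)
  have "expectation (\<lambda>\<omega>. (L 1 \<omega>)\<^sup>2) = expectation (\<lambda>\<omega>. (L 1 \<omega> - L 0 \<omega>)\<^sup>2)"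
    by (rule integral_cong_AE[OF _ _ L1_sq_AE]) auto
  also have "\<dots> = real m * v"
    using sums(2)[of m] h by simp
  finally have var1: "expectation (\<lambda>\<omega>. (L 1 \<omega>)\<^sup>2) = real m * v" .
  show "integrable M (\<lambda>\<omega>. (L (s + real k / real m) \<omega> - L s \<omega>)\<^sup>2)"
    using increment_integrable_iff[of "real k * h" "\<lambda>x. x\<^sup>2" s] sums(1)[of k] h by simp
  show "expectation (\<lambda>\<omega>. (L (s + real k / real m) \<omega> - L s \<omega>)\<^sup>2)
      = real k / real m * expectation (\<lambda>\<omega>. (L 1 \<omega>)\<^sup>2)"
    using increment_expectation[of "real k * h" "\<lambda>x. x\<^sup>2" s] sums(2)[of k] h m
    by (simp add: var1)
qed

text \<open>
  The expectation of \<open>\<bar>L q\<bar>\<close> grows like \<open>\<surd>\<bar>q\<bar>\<close> by the second moment. For negative \<open>q\<close> the increment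
  from \<open>q\<close> to \<open>0\<close> is used.
\<close>

lemma nn_integral_abs_rational_le:
  fixes j :: int
  assumes sq: "integrable M (\<lambda>\<omega>. (L 1 \<omega>)\<^sup>2)" and mean: "expectation (L 1) = 0"
    and m: "0 < m" and q: "q = real_of_int j / real m"
  shows "(\<integral>\<^sup>+\<omega>. ennreal \<bar>L q \<omega>\<bar> \<partial>M)
    \<le> ennreal ((expectation (\<lambda>\<omega>. (L 1 \<omega>)\<^sup>2) + 1) * sqrt (1 + \<bar>q\<bar>))"
proof -
  note [measurable] = random_variable_L
  let ?v = "expectation (\<lambda>\<omega>. (L 1 \<omega>)\<^sup>2)"
  define y where "y = sqrt (1 + \<bar>q\<bar>)"
  have y: "0 < y" "y * y = 1 + \<bar>q\<bar>"
    by (auto simp: y_def)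
  have v: "0 \<le> ?v"
    by simp
  have second: "integrable M (\<lambda>\<omega>. (L q \<omega> - L 0 \<omega>)\<^sup>2)"
    "expectation (\<lambda>\<omega>. (L q \<omega> - L 0 \<omega>)\<^sup>2) = \<bar>q\<bar> * ?v"
  proof -
    have "integrable M (\<lambda>\<omega>. (L q \<omega> - L 0 \<omega>)\<^sup>2) \<and>
        expectation (\<lambda>\<omega>. (L q \<omega> - L 0 \<omega>)\<^sup>2) = \<bar>q\<bar> * ?v"
    proof (cases "0 \<le> j")
      case True
      then show ?thesis
        using second_moment_rational_increment[OF sq mean m, of 0 "nat j"] by (simp add: q)
    next
      case False
      then have "q + real (nat (- j)) / real m = 0" "real (nat (- j)) / real m = \<bar>q\<bar>"
        using m by (simp_all add: q abs_if field_simps)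
      then show ?thesis
        using second_moment_rational_increment[OF sq mean m, of q "nat (- j)"]
        by (simp add: power2_commute)
    qed
    then show "integrable M (\<lambda>\<omega>. (L q \<omega> - L 0 \<omega>)\<^sup>2)"
      "expectation (\<lambda>\<omega>. (L q \<omega> - L 0 \<omega>)\<^sup>2) = \<bar>q\<bar> * ?v"
      by auto
  qed
  \<comment> \<open>As \<open>y\<close> is of the order of the standard deviation of \<open>L q\<close>, this serves as Cauchy--Schwarz.\<close>
  have "\<bar>x\<bar> \<le> x\<^sup>2 / y + y" for x
  proof (cases "\<bar>x\<bar> \<le> y")
    case False
    then have "\<bar>x\<bar> * y \<le> \<bar>x\<bar> * \<bar>x\<bar>"
      by (intro mult_left_mono) auto
    with y show ?thesis
      by (simp add: field_simps power2_eq_square)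
  qed (use y in \<open>simp add: add_increasing\<close>)
  then have "(\<integral>\<^sup>+\<omega>. ennreal \<bar>L q \<omega>\<bar> \<partial>M) \<le> (\<integral>\<^sup>+\<omega>. ennreal ((L q \<omega> - L 0 \<omega>)\<^sup>2 / y + y) \<partial>M)"
    using L_zero by (intro nn_integral_mono_AE) (auto intro!: ennreal_leI)
  also have "\<dots> = ennreal (expectation (\<lambda>\<omega>. (L q \<omega> - L 0 \<omega>)\<^sup>2 / y + y))"
    using second y by (intro nn_integral_eq_integral) auto
  also have "expectation (\<lambda>\<omega>. (L q \<omega> - L 0 \<omega>)\<^sup>2 / y + y) = \<bar>q\<bar> * ?v / y + y"
    using second by (simp add: prob_space)
  also have "\<bar>q\<bar> * ?v / y + y \<le> (?v + 1) * y"
  proof -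
    have "\<bar>q\<bar> * ?v \<le> (y * y) * ?v"
      using y v by (intro mult_right_mono) auto
    with y(1) show ?thesis
      by (simp add: field_simps)
  qed
  finally show ?thesis
    by (simp add: y_def ennreal_leI)
qed

end

section \<open>Almost sure integrability of the paths against the weight\<close>

lemma nn_integral_one_plus_abs_powr:
  assumes "p < -1"
  shows "(\<integral>\<^sup>+r. ennreal ((1 + \<bar>r\<bar>) powr p) \<partial>lborel) < \<infinity>"
proof -
  let ?f = "\<lambda>x::real. ennreal (indicator {1..} x * x powr p)"
  have "((\<lambda>x::real. x powr p) has_integral - (1 powr (p + 1)) / (p + 1)) {1..}"
    using assms by (intro has_integral_powr_to_inf) auto
  then have "(\<integral>\<^sup>+x. ?f x \<partial>lborel) = ennreal (- (1 powr (p + 1)) / (p + 1))"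
    by (intro nn_integral_has_integral_lebesgue) auto
  then have fin: "(\<integral>\<^sup>+x. ?f x \<partial>lborel) < \<infinity>"
    by simp
  have "(\<integral>\<^sup>+r. ennreal ((1 + \<bar>r\<bar>) powr p) \<partial>lborel)
      \<le> (\<integral>\<^sup>+r. ?f (1 + 1 * r) + ?f (1 + -1 * r) \<partial>lborel)"
    by (intro nn_integral_mono) (auto simp: indicator_def abs_if)
  also have "\<dots> = (\<integral>\<^sup>+r. ?f (1 + 1 * r) \<partial>lborel) + (\<integral>\<^sup>+r. ?f (1 + -1 * r) \<partial>lborel)"
    by (intro nn_integral_add) auto
  also have "\<dots> = (\<integral>\<^sup>+x. ?f x \<partial>lborel) + (\<integral>\<^sup>+x. ?f x \<partial>lborel)"
    using nn_integral_real_affine[of ?f 1 1] nn_integral_real_affine[of ?f "-1" 1] by simp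
  finally show ?thesis
    using fin by (simp add: order.strict_trans1)
qed

text \<open>
  By Tonelli's theorem it suffices that \<open>\<integral> (1 + \<bar>r\<bar>)\<^sup>p E\<bar>L r\<bar> dr\<close> is finite, which holds because
  \<open>E\<bar>L r\<bar> = O((1 + \<bar>r\<bar>)\<^sup>1\<^sup>/\<^sup>2)\<close> and \<open>p + 1/2 < -1\<close>. The path values are replaced by the lower limit
  of the values at the grid points: it is jointly measurable on the whole product space, it agrees
  with \<open>\<bar>L r\<bar>\<close> on every cadlag path, and Fatou's lemma carries the moment bound over to it from the rational
  grid points.
\<close>

lemma (in two_sided_levy_process) AE_weighted_path_integrable:
  assumes sq: "integrable M (\<lambda>\<omega>. (L 1 \<omega>)\<^sup>2)" and mean: "expectation (L 1) = 0"
    and p: "p < - 3 / 2"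
  shows "AE \<omega> in M. integrable lborel (\<lambda>r. (1 + \<bar>r\<bar>) powr p * L r \<omega>)"
proof -
  let ?w = "\<lambda>r::real. ennreal ((1 + \<bar>r\<bar>) powr p)"
  define C where "C = 2 * (expectation (\<lambda>\<omega>. (L 1 \<omega>)\<^sup>2) + 1)"
  have C: "0 \<le> C"
    by (simp add: C_def)
  note [measurable] = random_variable_L
  have joint [measurable]:
    "(\<lambda>(r, \<omega>). L (grid_above n r) \<omega>) \<in> borel_measurable (lborel \<Otimes>\<^sub>M M)" for n
    unfolding case_prod_beta'
    by (rule borel_measurable_grid_above[where H="\<lambda>t z. L t (snd z)" and \<phi>=fst]) auto
  have grid_moment: "(\<integral>\<^sup>+\<omega>. ennreal \<bar>L (grid_above n r) \<omega>\<bar> \<partial>M) \<le> ennreal (C * sqrt (1 + \<bar>r\<bar>))" for n r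
  proof -
  \<comment> \<open>Since \<open>\<bar>grid_above n r\<bar> \<le> \<bar>r\<bar> + 1\<close>, passing to the grid costs a factor \<open>2\<close>.\<close>
    have "1 / real (Suc n) \<le> 1"
      by simp
    then have "\<bar>grid_above n r\<bar> \<le> \<bar>r\<bar> + 1"
      using grid_above_bounds(1)[of r n] grid_above_bounds(2)[of n r] by linarith
    then have "sqrt (1 + \<bar>grid_above n r\<bar>) \<le> sqrt (4 * (1 + \<bar>r\<bar>))"
      by (intro real_sqrt_le_mono) auto
    also have "\<dots> = 2 * sqrt (1 + \<bar>r\<bar>)"
      unfolding real_sqrt_mult by simp
    finally have "(expectation (\<lambda>\<omega>. (L 1 \<omega>)\<^sup>2) + 1) * sqrt (1 + \<bar>grid_above n r\<bar>)
        \<le> (expectation (\<lambda>\<omega>. (L 1 \<omega>)\<^sup>2) + 1) * (2 * sqrt (1 + \<bar>r\<bar>))"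
      by (intro mult_left_mono) auto
    also have "\<dots> = C * sqrt (1 + \<bar>r\<bar>)"
      unfolding C_def by (simp only: mult_ac)
    finally show ?thesis
      by (intro order_trans[OF nn_integral_abs_rational_le[OF sq mean _ grid_above_def] ennreal_leI])
        auto
  qed
  have limit_moment: "(\<integral>\<^sup>+\<omega>. liminf (\<lambda>n. ennreal \<bar>L (grid_above n r) \<omega>\<bar>) \<partial>M)
      \<le> ennreal (C * sqrt (1 + \<bar>r\<bar>))" for r
  proof -
    have "(\<integral>\<^sup>+\<omega>. liminf (\<lambda>n. ennreal \<bar>L (grid_above n r) \<omega>\<bar>) \<partial>M)
        \<le> liminf (\<lambda>n. \<integral>\<^sup>+\<omega>. ennreal \<bar>L (grid_above n r) \<omega>\<bar> \<partial>M)"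
      by (intro nn_integral_liminf) measurable
    also have "\<dots> \<le> liminf (\<lambda>n::nat. ennreal (C * sqrt (1 + \<bar>r\<bar>)))"
      by (intro Liminf_mono always_eventually allI grid_moment)
    finally show ?thesis
      by (simp add: Liminf_const)
  qed
  interpret lborel_M: pair_sigma_finite lborel M ..
  have "(\<integral>\<^sup>+\<omega>. \<integral>\<^sup>+r. ?w r * liminf (\<lambda>n. ennreal \<bar>L (grid_above n r) \<omega>\<bar>) \<partial>lborel \<partial>M)
      = (\<integral>\<^sup>+r. \<integral>\<^sup>+\<omega>. ?w r * liminf (\<lambda>n. ennreal \<bar>L (grid_above n r) \<omega>\<bar>) \<partial>M \<partial>lborel)"
    by (intro lborel_M.Fubini') measurable
  also have "\<dots> \<le> (\<integral>\<^sup>+r. ennreal C * ennreal ((1 + \<bar>r\<bar>) powr (p + 1 / 2)) \<partial>lborel)"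
  proof (intro nn_integral_mono)
    fix r :: real
    have "(\<integral>\<^sup>+\<omega>. ?w r * liminf (\<lambda>n. ennreal \<bar>L (grid_above n r) \<omega>\<bar>) \<partial>M)
        = ?w r * (\<integral>\<^sup>+\<omega>. liminf (\<lambda>n. ennreal \<bar>L (grid_above n r) \<omega>\<bar>) \<partial>M)"
      by (intro nn_integral_cmult) measurable
    also have "\<dots> \<le> ?w r * ennreal (C * sqrt (1 + \<bar>r\<bar>))"
      by (intro mult_left_mono limit_moment) auto
    also have "\<dots> = ennreal C * ennreal ((1 + \<bar>r\<bar>) powr (p + 1 / 2))"
      using C by (simp add: ennreal_mult'[symmetric] powr_add powr_half_sqrt mult_ac)
    finally show "(\<integral>\<^sup>+\<omega>. ?w r * liminf (\<lambda>n. ennreal \<bar>L (grid_above n r) \<omega>\<bar>) \<partial>M)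
        \<le> ennreal C * ennreal ((1 + \<bar>r\<bar>) powr (p + 1 / 2))" .
  qed
  also have "\<dots> = ennreal C * (\<integral>\<^sup>+r. ennreal ((1 + \<bar>r\<bar>) powr (p + 1 / 2)) \<partial>lborel)"
    by (intro nn_integral_cmult) measurable
  also have "\<dots> < \<infinity>"
    using nn_integral_one_plus_abs_powr[of "p + 1 / 2"] p by (simp add: ennreal_mult_less_top)
  finally have "AE \<omega> in M.
      (\<integral>\<^sup>+r. ?w r * liminf (\<lambda>n. ennreal \<bar>L (grid_above n r) \<omega>\<bar>) \<partial>lborel) \<noteq> \<infinity>"
    by (intro nn_integral_PInf_AE) auto
  with cadlag_paths show ?thesis
  proof eventually_elim
    case (elim \<omega>)
    have [measurable]: "(\<lambda>r. L r \<omega>) \<in> borel_measurable borel"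
      using elim(1) by (rule cadlag_borel_measurable)
    have "liminf (\<lambda>n. ennreal \<bar>L (grid_above n r) \<omega>\<bar>) = ennreal \<bar>L r \<omega>\<bar>" for r
      by (intro lim_imp_Liminf tendsto_ennrealI tendsto_rabs cadlag_grid_above[OF elim(1)]) simp
    with elim(2) have "(\<integral>\<^sup>+r. ennreal (norm ((1 + \<bar>r\<bar>) powr p * L r \<omega>)) \<partial>lborel) < \<infinity>"
      by (simp add: abs_mult ennreal_mult' less_top)
    then show ?case
      by (intro integrableI_bounded) auto
  qed
qed

section \<open>Hoelder continuity of fractional Levy paths\<close>

theorem theorem1p6:
  fixes M :: "'w measure" and L M\<^sub>d :: "real \<Rightarrow> 'w \<Rightarrow> real" and d :: real
  assumes "0 < d" and "d < 1 / 2"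
    and "fractional_levy_process M L d M\<^sub>d"
  shows "AE \<omega> in M. \<forall>t. \<exists>\<delta>\<^sub>0>0. \<exists>C. \<forall>\<delta>. - \<delta>\<^sub>0 < \<delta> \<and> \<delta> < \<delta>\<^sub>0 \<longrightarrow>
           \<bar>M\<^sub>d (t + \<delta>) \<omega> - M\<^sub>d t \<omega>\<bar> \<le> C * \<bar>\<delta>\<bar> powr d"
proof -
  interpret fractional_levy_process M L d M\<^sub>d
    by (rule assms(3))
  \<comment> \<open>The exponent \<open>d - 2\<close> is below \<open>-3/2\<close> exactly because \<open>d < 1/2\<close>.\<close>
  have "AE \<omega> in M. integrable lborel (\<lambda>r. (1 + \<bar>r\<bar>) powr (d - 2) * L r \<omega>)"
    using assms(2) by (intro AE_weighted_path_integrable square_integrable centered) simp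
  with cadlag_paths pathwise_representation show ?thesis
  proof eventually_elim
    case (elim \<omega>)
    define F where
      "F t = (LINT r|lborel. (frac_kernel d t r - frac_kernel d 0 r) * L r \<omega>)" for t
    have M\<^sub>d_eq: "M\<^sub>d t \<omega> = 1 / Gamma d * F t" for t
      using elim(2) by (simp add: F_def frac_kernel_def)
    show ?case
    proof
      fix t :: real
      have "(\<lambda>r. L r \<omega>) \<in> borel_measurable borel" "bounded ((\<lambda>r. L r \<omega>) ` {a..b})" for a b
        using elim(1) by (rule cadlag_borel_measurable, rule cadlag_bounded)
      then obtain C where C: "\<And>\<delta>. \<bar>\<delta>\<bar> < 1 \<Longrightarrow> \<bar>F (t + \<delta>) - F t\<bar> \<le> C * \<bar>\<delta>\<bar> powr d"
        unfolding F_def using elim(3) assms(1,2)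
        by (elim frac_integral_pointwise_Hoelder[rotated 2]) auto
      have "\<bar>M\<^sub>d (t + \<delta>) \<omega> - M\<^sub>d t \<omega>\<bar> \<le> (\<bar>1 / Gamma d\<bar> * C) * \<bar>\<delta>\<bar> powr d"
        if "- 1 < \<delta>" "\<delta> < 1" for \<delta>
      proof -
        have "\<bar>M\<^sub>d (t + \<delta>) \<omega> - M\<^sub>d t \<omega>\<bar> = \<bar>1 / Gamma d\<bar> * \<bar>F (t + \<delta>) - F t\<bar>"
          unfolding M\<^sub>d_eq by (simp only: right_diff_distrib[symmetric] abs_mult)
        also have "\<dots> \<le> \<bar>1 / Gamma d\<bar> * (C * \<bar>\<delta>\<bar> powr d)"
          using C[of \<delta>] that by (intro mult_left_mono) auto
        finally show ?thesis
          by (simp only: mult.assoc)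
      qed
      then show "\<exists>\<delta>\<^sub>0>0. \<exists>C. \<forall>\<delta>. - \<delta>\<^sub>0 < \<delta> \<and> \<delta> < \<delta>\<^sub>0 \<longrightarrow>
          \<bar>M\<^sub>d (t + \<delta>) \<omega> - M\<^sub>d t \<omega>\<bar> \<le> C * \<bar>\<delta>\<bar> powr d"
        by (intro exI[of _ 1] conjI exI[of _ "\<bar>1 / Gamma d\<bar> * C"]) auto
    qed
  qed
qed

end
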